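(* (a) Let $\mathcal{M}=(M,\mathit{TRUE},f_\vee,f_\wedge,f_\neg,f_\bot,f_\top,f_\rightarrow,f_\equiv,\preceq)$ be an $\mathit{SCI}$-model (in the Boolean prealgebra sense). Then the pair $\langle\mathcal{A},\mathit{TRUE}\rangle$ with $\mathcal{A}=(M,f_\neg,f_\rightarrow,f_\equiv)$ is a Bloom–Suszko model of $\mathit{SCI}$. (b) Conversely, let $\langle\mathcal{A},B\rangle$ with $\mathcal{A}=(A,f_\neg,f_\rightarrow,f_\equiv)$ be a Bloom–Suszko model of $\mathit{SCI}$. Define $a\preceq b :\Leftrightarrow f_\rightarrow(a,b)\in B$ for $a,b\in A$, and define the additional operations by the usual Boolean equations: $f_\vee(a,b):=f_\rightarrow(f_\neg(a),b)$, $f_\wedge(a,b):=f_\neg(f_\rightarrow(a,f_\neg(b)))$, $f_\top:=f_\rightarrow(a_0,a_0)$ for some fixed $a_0\in A$, and $f_\bot:=f_\neg(f_\top)$. Then $(A,B,f_\vee,f_\wedge,f_\neg,f_\bot,f_\top,f_\rightarrow,f_\equiv,\preceq)$ is an $\mathit{SCI}$-model (in the Boolean prealgebra sense).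
   Context: Boolean prealgebras. A Boolean algebra is regarded as a structure $(B,f_\vee,f_\wedge,f_\neg,f_\bot,f_\top,f_\rightarrow)$ with the usual operations, where $f_\rightarrow(a,b)=f_\vee(f_\neg(a),b)$. A structure $\mathcal{B}=(B,f_\vee,f_\wedge,f_\neg,f_\bot,f_\top,f_\rightarrow,\preceq)$ with operations of arities $(2,2,1,0,0,2)$ and a preorder $\preceq$ on $B$ is a Boolean prealgebra if the relation $a\approx b:\Leftrightarrow(a\preceq b$ and $b\preceq a)$ is a congruence relation for the operations, the quotient $\mathcal{B}/{\approx}$ is a Boolean algebra, and for all $a,b\in B$: $a\preceq b\Leftrightarrow f_\wedge(a,b)\approx a$. A subset $F\subseteq B$ closed under $\approx$ (i.e. $a\approx b$ implies $a\in F\Leftrightarrow b\in F$) is an ultrafilter of $\mathcal{B}$ if $\{\overline{a}\mid a\in F\}$ is an ultrafilter of the Boolean algebra $\mathcal{B}/{\approx}$, where $\overline{a}$ is the $\approx$-class of $a$. $\mathit{SCI}$-model (Boolean prealgebra sense): a structure $(M,\mathit{TRUE},f_\vee,f_\wedge,f_\neg,f_\bot,f_\top,f_\rightarrow,f_\equiv,\preceq)$ such that $(M,f_\vee,f_\wedge,f_\neg,f_\bot,f_\top,f_\rightarrow,\preceq)$ is a Boolean prealgebra, $\mathit{TRUE}\subseteq M$ is an ultrafilter of it, and $f_\equiv$ is a binary function on $M$ with $f_\equiv(m,m')\in\mathit{TRUE}\Leftrightarrow m=m'$ for all $m,m'\in M$. Bloom–Suszko model: Consider formulas built from variables with the connectives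 $\neg,\rightarrow,\equiv$ only. Let $\mathcal{A}=(A,f_\neg,f_\rightarrow,f_\equiv)$ be an algebra of type $(1,2,2)$; a valuation $h$ is a homomorphism from the formula algebra to $\mathcal{A}$. A set $B\subseteq A$ is: closed if $a\in B$ and $f_\rightarrow(a,b)\in B$ imply $b\in B$; proper if $B\neq A$; admissible if for every valuation $h$, $h(\varphi)\in B$ for every axiom $\varphi$, the axioms being all substitution instances of classical tautologies in $\neg,\rightarrow$, and all formulas of the forms $\varphi\equiv\varphi$, $(\varphi\equiv\psi)\rightarrow(\varphi\rightarrow\psi)$, $(\varphi\equiv\psi)\rightarrow(\neg\varphi\equiv\neg\psi)$, and $(\varphi_1\equiv\psi_1)\rightarrow((\varphi_2\equiv\psi_2)\rightarrow((\varphi_1*\varphi_2)\equiv(\psi_1*\psi_2)))$ for $*\in\{\rightarrow,\equiv\}$; a filter if it is closed and admissible; prime if it is proper and for every $a\in A$, $a\in B$ or $f_\neg(a)\in B$; normal if $f_\equiv(a,b)\in B$ implies $a=b$. A Bloom–Suszko model of $\mathit{SCI}$ is a pair $\langle\mathcal{A},B\rangle$ where $B\subseteq A$ is a prime, normal filter. *)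

theory Defs
  imports Main
begin

section \<open>Boolean algebras and ultrafilters\<close>

text \<open>
  The library's Boolean algebras live on whole types. The quotients below are carried by sets of
  equivalence classes, so Boolean algebras are introduced here on an explicit carrier set. Operations
  are total HOL functions, and only their values on the carrier matter.
\<close>

record 'a bool_struct =
  carr :: "'a set"
  f_or :: "'a \<Rightarrow> 'a \<Rightarrow> 'a"
  f_and :: "'a \<Rightarrow> 'a \<Rightarrow> 'a"
  f_neg :: "'a \<Rightarrow> 'a"
  f_bot :: 'a
  f_top :: 'a
  f_imp :: "'a \<Rightarrow> 'a \<Rightarrow> 'a"

definition closed_ops :: "('a, 'm) bool_struct_scheme \<Rightarrow> bool" where
  "closed_ops S \<longleftrightarrow>
     (\<forall>a\<in>carr S. \<forall>b\<in>carr S. f_or S a b \<in> carr S \<and> f_and S a b \<in> carr S \<and> f_imp S a b \<in> carr S) \<and>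
     (\<forall>a\<in>carr S. f_neg S a \<in> carr S) \<and>
     f_bot S \<in> carr S \<and> f_top S \<in> carr S"

text \<open>The one-element algebra is not excluded, but it has no ultrafilter.\<close>

definition boolean_algebra_on :: "('a, 'm) bool_struct_scheme \<Rightarrow> bool" where
  "boolean_algebra_on S \<longleftrightarrow>
     closed_ops S \<and>
     (\<forall>a\<in>carr S. \<forall>b\<in>carr S. \<forall>c\<in>carr S.
        f_or S (f_or S a b) c = f_or S a (f_or S b c) \<and>
        f_and S (f_and S a b) c = f_and S a (f_and S b c) \<and>
        f_and S a (f_or S b c) = f_or S (f_and S a b) (f_and S a c) \<and>
        f_or S a (f_and S b c) = f_and S (f_or S a b) (f_or S a c)) \<and>
     (\<forall>a\<in>carr S. \<forall>b\<in>carr S.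
        f_or S a b = f_or S b a \<and>
        f_and S a b = f_and S b a \<and>
        f_or S a (f_and S a b) = a \<and>
        f_and S a (f_or S a b) = a \<and>
        f_imp S a b = f_or S (f_neg S a) b) \<and>
     (\<forall>a\<in>carr S.
        f_or S a (f_bot S) = a \<and>
        f_and S a (f_top S) = a \<and>
        f_or S a (f_neg S a) = f_top S \<and>
        f_and S a (f_neg S a) = f_bot S)"

definition ba_filter :: "('a, 'm) bool_struct_scheme \<Rightarrow> 'a set \<Rightarrow> bool" where
  "ba_filter S F \<longleftrightarrow>
     F \<subseteq> carr S \<and> F \<noteq> {} \<and>
     (\<forall>a\<in>F. \<forall>b\<in>F. f_and S a b \<in> F) \<and>
     (\<forall>a\<in>F. \<forall>b\<in>carr S. f_and S a b = a \<longrightarrow> b \<in> F)"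

text \<open>Ultrafilters are the maximal proper filters.\<close>

definition ba_ultrafilter :: "('a, 'm) bool_struct_scheme \<Rightarrow> 'a set \<Rightarrow> bool" where
  "ba_ultrafilter S F \<longleftrightarrow>
     ba_filter S F \<and> F \<noteq> carr S \<and>
     (\<forall>G. ba_filter S G \<and> G \<noteq> carr S \<and> F \<subseteq> G \<longrightarrow> G = F)"


section \<open>Boolean prealgebras\<close>

record 'a bool_prestruct = "'a bool_struct" +
  le :: "'a rel"

definition approx :: "('a, 'm) bool_prestruct_scheme \<Rightarrow> 'a rel" where
  "approx S = {(a, b). (a, b) \<in> le S \<and> (b, a) \<in> le S}"

definition is_congruence :: "('a, 'm) bool_struct_scheme \<Rightarrow> 'a rel \<Rightarrow> bool" where
  "is_congruence S r \<longleftrightarrow>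
     equiv (carr S) r \<and>
     (\<forall>(a, a')\<in>r. (f_neg S a, f_neg S a') \<in> r) \<and>
     (\<forall>(a, a')\<in>r. \<forall>(b, b')\<in>r.
        (f_or S a b, f_or S a' b') \<in> r \<and>
        (f_and S a b, f_and S a' b') \<in> r \<and>
        (f_imp S a b, f_imp S a' b') \<in> r)"

text \<open>
  When \<open>r\<close> is a congruence, each union below is a union of equal sets, so that for instance
  \<open>f_or\<close> of the quotient maps the classes of \<open>a\<close> and \<open>b\<close> to the class of \<open>f_or S a b\<close>.
\<close>

definition quotient_struct :: "('a, 'm) bool_struct_scheme \<Rightarrow> 'a rel \<Rightarrow> 'a set bool_struct" where
  "quotient_struct S r =
     \<lparr>carr = carr S // r,
      f_or = (\<lambda>X Y. \<Union>a\<in>X. \<Union>b\<in>Y. r `` {f_or S a b}),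
      f_and = (\<lambda>X Y. \<Union>a\<in>X. \<Union>b\<in>Y. r `` {f_and S a b}),
      f_neg = (\<lambda>X. \<Union>a\<in>X. r `` {f_neg S a}),
      f_bot = r `` {f_bot S},
      f_top = r `` {f_top S},
      f_imp = (\<lambda>X Y. \<Union>a\<in>X. \<Union>b\<in>Y. r `` {f_imp S a b})\<rparr>"

definition boolean_prealgebra :: "('a, 'm) bool_prestruct_scheme \<Rightarrow> bool" where
  "boolean_prealgebra S \<longleftrightarrow>
     closed_ops S \<and>
     preorder_on (carr S) (le S) \<and>
     is_congruence S (approx S) \<and>
     boolean_algebra_on (quotient_struct S (approx S)) \<and>
     (\<forall>a\<in>carr S. \<forall>b\<in>carr S. (a, b) \<in> le S \<longleftrightarrow> (f_and S a b, a) \<in> approx S)"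

definition prealgebra_ultrafilter :: "('a, 'm) bool_prestruct_scheme \<Rightarrow> 'a set \<Rightarrow> bool" where
  "prealgebra_ultrafilter S F \<longleftrightarrow>
     F \<subseteq> carr S \<and>
     (\<forall>(a, b)\<in>approx S. a \<in> F \<longleftrightarrow> b \<in> F) \<and>
     ba_ultrafilter (quotient_struct S (approx S)) {approx S `` {a} | a. a \<in> F}"

record 'a sci_struct = "'a bool_prestruct" +
  TRUE :: "'a set"
  f_id :: "'a \<Rightarrow> 'a \<Rightarrow> 'a"

definition sci_model :: "'a sci_struct \<Rightarrow> bool" where
  "sci_model M \<longleftrightarrow>
     boolean_prealgebra M \<and>
     prealgebra_ultrafilter M (TRUE M) \<and>
     (\<forall>m\<in>carr M. \<forall>m'\<in>carr M. f_id M m m' \<in> carr M) \<and>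
     (\<forall>m\<in>carr M. \<forall>m'\<in>carr M. f_id M m m' \<in> TRUE M \<longleftrightarrow> m = m')"


section \<open>Formulas and axioms of SCI\<close>

datatype fm = Var nat | Neg fm | Imp fm fm | Idn fm fm

text \<open>Identity-free formulas, used only to say what a classical tautology is.\<close>

datatype cfm = CVar nat | CNeg cfm | CImp cfm cfm

primrec truth :: "(nat \<Rightarrow> bool) \<Rightarrow> cfm \<Rightarrow> bool" where
  "truth v (CVar n) = v n"
| "truth v (CNeg p) = (\<not> truth v p)"
| "truth v (CImp p q) = (truth v p \<longrightarrow> truth v q)"

definition tautology :: "cfm \<Rightarrow> bool" where
  "tautology p \<longleftrightarrow> (\<forall>v. truth v p)"

primrec subst :: "(nat \<Rightarrow> fm) \<Rightarrow> cfm \<Rightarrow> fm" where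
  "subst \<sigma> (CVar n) = \<sigma> n"
| "subst \<sigma> (CNeg p) = Neg (subst \<sigma> p)"
| "subst \<sigma> (CImp p q) = Imp (subst \<sigma> p) (subst \<sigma> q)"

inductive_set sci_axioms :: "fm set" where
  taut: "tautology p \<Longrightarrow> subst \<sigma> p \<in> sci_axioms"
| id_refl: "Idn \<phi> \<phi> \<in> sci_axioms"
| id_imp: "Imp (Idn \<phi> \<psi>) (Imp \<phi> \<psi>) \<in> sci_axioms"
| cong_neg: "Imp (Idn \<phi> \<psi>) (Idn (Neg \<phi>) (Neg \<psi>)) \<in> sci_axioms"
| cong_imp: "Imp (Idn \<phi>1 \<psi>1) (Imp (Idn \<phi>2 \<psi>2) (Idn (Imp \<phi>1 \<phi>2) (Imp \<psi>1 \<psi>2))) \<in> sci_axioms"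
| cong_id: "Imp (Idn \<phi>1 \<psi>1) (Imp (Idn \<phi>2 \<psi>2) (Idn (Idn \<phi>1 \<phi>2) (Idn \<psi>1 \<psi>2))) \<in> sci_axioms"


section \<open>Bloom-Suszko models\<close>

record 'a sci_algebra =
  base :: "'a set"
  g_neg :: "'a \<Rightarrow> 'a"
  g_imp :: "'a \<Rightarrow> 'a \<Rightarrow> 'a"
  g_id :: "'a \<Rightarrow> 'a \<Rightarrow> 'a"

definition is_sci_algebra :: "'a sci_algebra \<Rightarrow> bool" where
  "is_sci_algebra A \<longleftrightarrow>
     (\<forall>a\<in>base A. g_neg A a \<in> base A) \<and>
     (\<forall>a\<in>base A. \<forall>b\<in>base A. g_imp A a b \<in> base A \<and> g_id A a b \<in> base A)"

definition valuation :: "'a sci_algebra \<Rightarrow> (fm \<Rightarrow> 'a) \<Rightarrow> bool" where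
  "valuation A h \<longleftrightarrow>
     range h \<subseteq> base A \<and>
     (\<forall>\<phi>. h (Neg \<phi>) = g_neg A (h \<phi>)) \<and>
     (\<forall>\<phi> \<psi>. h (Imp \<phi> \<psi>) = g_imp A (h \<phi>) (h \<psi>)) \<and>
     (\<forall>\<phi> \<psi>. h (Idn \<phi> \<psi>) = g_id A (h \<phi>) (h \<psi>))"

definition mp_closed :: "'a sci_algebra \<Rightarrow> 'a set \<Rightarrow> bool" where
  "mp_closed A B \<longleftrightarrow> (\<forall>a\<in>base A. \<forall>b\<in>base A. a \<in> B \<and> g_imp A a b \<in> B \<longrightarrow> b \<in> B)"

definition proper :: "'a sci_algebra \<Rightarrow> 'a set \<Rightarrow> bool" where
  "proper A B \<longleftrightarrow> B \<noteq> base A"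

definition admissible :: "'a sci_algebra \<Rightarrow> 'a set \<Rightarrow> bool" where
  "admissible A B \<longleftrightarrow> (\<forall>h. valuation A h \<longrightarrow> (\<forall>\<phi>\<in>sci_axioms. h \<phi> \<in> B))"

definition sci_filter :: "'a sci_algebra \<Rightarrow> 'a set \<Rightarrow> bool" where
  "sci_filter A B \<longleftrightarrow> mp_closed A B \<and> admissible A B"

definition prime_set :: "'a sci_algebra \<Rightarrow> 'a set \<Rightarrow> bool" where
  "prime_set A B \<longleftrightarrow> proper A B \<and> (\<forall>a\<in>base A. a \<in> B \<or> g_neg A a \<in> B)"

definition normal :: "'a sci_algebra \<Rightarrow> 'a set \<Rightarrow> bool" where
  "normal A B \<longleftrightarrow> (\<forall>a\<in>base A. \<forall>b\<in>base A. g_id A a b \<in> B \<longrightarrow> a = b)"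

definition bloom_suszko_model :: "'a sci_algebra \<Rightarrow> 'a set \<Rightarrow> bool" where
  "bloom_suszko_model A B \<longleftrightarrow>
     is_sci_algebra A \<and> B \<subseteq> base A \<and> sci_filter A B \<and> prime_set A B \<and> normal A B"

end

theory Submission
  imports Defs
begin

text \<open>
  In both notions of model the designated set splits the carrier into true
  and false elements in such a way that negation and implication behave classically and
  \<open>\<equiv>\<close> is true exactly on the diagonal. For a Bloom-Suszko model this follows from three
  tautologies, modus ponens and primality; for an SCI-model it is the primality of ultrafilters in
  Boolean algebras. Conversely, such a set satisfies all axioms by induction on tautologies, and the
  quotient of the Boolean prealgebra it defines is the two-element Boolean algebra.
\<close>

section \<open>Two-valued sets and Bloom-Suszko models\<close>

definition two_valued :: "'a sci_algebra \<Rightarrow> 'a set \<Rightarrow> bool" where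
  "two_valued A B \<longleftrightarrow>
     (\<forall>a\<in>base A. g_neg A a \<in> B \<longleftrightarrow> a \<notin> B) \<and>
     (\<forall>a\<in>base A. \<forall>b\<in>base A. g_imp A a b \<in> B \<longleftrightarrow> (a \<in> B \<longrightarrow> b \<in> B)) \<and>
     (\<forall>a\<in>base A. \<forall>b\<in>base A. g_id A a b \<in> B \<longleftrightarrow> a = b)"

text \<open>The homomorphic extension of a variable assignment. Admissibility quantifies over
  valuations, so this is how it is applied at chosen elements of the carrier.\<close>

primrec eval_fm :: "'a sci_algebra \<Rightarrow> (nat \<Rightarrow> 'a) \<Rightarrow> fm \<Rightarrow> 'a" where
  "eval_fm A v (Var n) = v n"
| "eval_fm A v (Neg p) = g_neg A (eval_fm A v p)"
| "eval_fm A v (Imp p q) = g_imp A (eval_fm A v p) (eval_fm A v q)"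
| "eval_fm A v (Idn p q) = g_id A (eval_fm A v p) (eval_fm A v q)"

lemma valuation_eval_fm:
  assumes "is_sci_algebra A" "\<And>n. v n \<in> base A"
  shows "valuation A (eval_fm A v)"
proof -
  have "eval_fm A v p \<in> base A" for p
    by (induction p) (use assms in \<open>auto simp: is_sci_algebra_def\<close>)
  then show ?thesis
    by (auto simp: valuation_def)
qed

text \<open>Substituting \<open>Var\<close> for the schematic variables keeps the shape of the
  tautology, so evaluation turns it into a term of the algebra in the elements
  \<open>v n\<close>.\<close>

lemma admissible_taut:
  assumes "is_sci_algebra A" "admissible A B" "tautology p" "\<And>n. v n \<in> base A"
  shows "eval_fm A v (subst Var p) \<in> B"
  using assms valuation_eval_fm[of A v] sci_axioms.taut[of p Var]
  unfolding admissible_def by blast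

text \<open>Membership in \<open>B\<close> commutes with negation and implication, hence acts as a
  classical truth assignment.\<close>

lemma truth_valuation:
  assumes "two_valued A B" "valuation A h"
  shows "h (subst \<sigma> p) \<in> B \<longleftrightarrow> truth (\<lambda>n. h (\<sigma> n) \<in> B) p"
proof (induction p)
  case (CVar n)
  then show ?case by simp
next
  case (CNeg p)
  then show ?case using assms by (auto simp: two_valued_def valuation_def)
next
  case (CImp p q)
  have "h (subst \<sigma> p) \<in> base A" "h (subst \<sigma> q) \<in> base A"
    using assms(2) by (auto simp: valuation_def)
  then show ?case using assms CImp by (simp add: two_valued_def valuation_def)
qed

lemma admissible_if_two_valued:
  assumes "is_sci_algebra A" "two_valued A B"
  shows "admissible A B"
  unfolding admissible_def
proof (intro allI impI ballI)
  fix h \<phi>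
  assume h: "valuation A h" and "\<phi> \<in> sci_axioms"
  have base: "h \<psi> \<in> base A" for \<psi>
    using h by (auto simp: valuation_def)
  have h_simps:
    "h (Neg \<psi>) = g_neg A (h \<psi>)"
    "h (Imp \<psi> \<chi>) = g_imp A (h \<psi>) (h \<chi>)"
    "h (Idn \<psi> \<chi>) = g_id A (h \<psi>) (h \<chi>)" for \<psi> \<chi>
    using h by (auto simp: valuation_def)
  have imp: "h (Imp \<psi> \<chi>) \<in> B \<longleftrightarrow> (h \<psi> \<in> B \<longrightarrow> h \<chi> \<in> B)" for \<psi> \<chi>
    using assms base[of \<psi>] base[of \<chi>] by (simp add: two_valued_def h_simps)
  have idn: "h (Idn \<psi> \<chi>) \<in> B \<longleftrightarrow> h \<psi> = h \<chi>" for \<psi> \<chi>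
    using assms base[of \<psi>] base[of \<chi>] by (simp add: two_valued_def h_simps)
  from \<open>\<phi> \<in> sci_axioms\<close> show "h \<phi> \<in> B"
  proof cases
    case (taut p \<sigma>)
    then show ?thesis
      using truth_valuation[OF assms(2) h] by (simp add: tautology_def)
  \<comment> \<open>The identity axioms: a true \<open>Idn\<close> means equal values, and equal
    values remain equal under the operations. After \<open>imp\<close> and \<open>idn\<close>, the
    congruence axioms still need \<open>h_simps\<close> to expose those operations.\<close>
  qed (auto simp: imp idn, auto simp: h_simps)
qed

text \<open>Forwards, the truth tables come from modus ponens with three tautologies, and the
  identity condition from reflexivity and normality. Backwards, the truth tables give modus ponens
  and primality directly, and admissibility by \<open>admissible_if_two_valued\<close>.\<close>

lemma bloom_suszko_model_iff:
  "bloom_suszko_model A B \<longleftrightarrow>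
     is_sci_algebra A \<and> B \<subseteq> base A \<and> base A \<noteq> {} \<and> two_valued A B"
proof
  assume model: "bloom_suszko_model A B"
  then have alg: "is_sci_algebra A" and sub: "B \<subseteq> base A" and adm: "admissible A B"
    and mp: "mp_closed A B" and prime: "prime_set A B" and norm: "normal A B"
    by (auto simp: bloom_suszko_model_def sci_filter_def)
  have closed: "g_neg A a \<in> base A" "g_imp A a b \<in> base A" if "a \<in> base A" "b \<in> base A" for a b
    using alg that by (auto simp: is_sci_algebra_def)
  have MP: "b \<in> B" if "g_imp A a b \<in> B" "a \<in> B" "b \<in> base A" for a b
    using mp sub that by (auto simp: mp_closed_def)
  \<comment> \<open>Variable 0 is sent to \<open>a\<close> and every other variable to
    \<open>b\<close>. \<open>explosion\<close> will show that a contradiction in \<open>B\<close>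
    makes it improper; the other two give the true cases of implication, by a true consequent and by
    a false antecedent.\<close>
  have explosion: "g_imp A a (g_imp A (g_neg A a) b) \<in> B"
    and weakening: "g_imp A b (g_imp A a b) \<in> B"
    and vacuous: "g_imp A (g_neg A a) (g_imp A a b) \<in> B"
    if "a \<in> base A" "b \<in> base A" for a b
    using admissible_taut[OF alg adm, of "CImp (CVar 0) (CImp (CNeg (CVar 0)) (CVar 1))"
        "\<lambda>n. if n = 0 then a else b"]
      admissible_taut[OF alg adm, of "CImp (CVar 1) (CImp (CVar 0) (CVar 1))"
        "\<lambda>n. if n = 0 then a else b"]
      admissible_taut[OF alg adm, of "CImp (CNeg (CVar 0)) (CImp (CVar 0) (CVar 1))"
        "\<lambda>n. if n = 0 then a else b"] that
    by (auto simp: tautology_def)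
  have neg: "g_neg A a \<in> B \<longleftrightarrow> a \<notin> B" if a: "a \<in> base A" for a
  proof
    assume neg: "g_neg A a \<in> B"
    show "a \<notin> B"
    proof
      assume "a \<in> B"
      then have "b \<in> B" if "b \<in> base A" for b
        using MP[OF MP[OF explosion[OF a that]] neg] closed a that by auto
      then show False
        using prime sub by (auto simp: prime_set_def proper_def)
    qed
  qed (use prime a in \<open>auto simp: prime_set_def\<close>)
  have imp: "g_imp A a b \<in> B \<longleftrightarrow> (a \<in> B \<longrightarrow> b \<in> B)" if "a \<in> base A" "b \<in> base A" for a b
    using MP[OF weakening[OF that]] MP[OF vacuous[OF that]] MP[of a b] neg[of a] closed that
    by auto
  \<comment> \<open>Normality yields equality from a true identity; the reflexivity axiom supplies
    the converse.\<close>
  have idn: "g_id A a a \<in> B" if "a \<in> base A" for a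
  proof -
    have "valuation A (eval_fm A (\<lambda>_. a))"
      using alg that by (intro valuation_eval_fm)
    then have "eval_fm A (\<lambda>_. a) (Idn (Var 0) (Var 0)) \<in> B"
      using adm sci_axioms.id_refl unfolding admissible_def by blast
    then show ?thesis by simp
  qed
  \<comment> \<open>Over an empty carrier, \<open>B\<close> would equal the carrier and not be
    proper.\<close>
  have "base A \<noteq> {}"
    using prime sub by (auto simp: prime_set_def proper_def)
  moreover have "two_valued A B"
    using neg imp idn norm by (auto simp: two_valued_def normal_def)
  ultimately show "is_sci_algebra A \<and> B \<subseteq> base A \<and> base A \<noteq> {} \<and> two_valued A B"
    using alg sub by blast
next
  assume *: "is_sci_algebra A \<and> B \<subseteq> base A \<and> base A \<noteq> {} \<and> two_valued A B"
  then have "mp_closed A B" "normal A B"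
    by (auto simp: mp_closed_def normal_def two_valued_def)
  \<comment> \<open>Properness: for any \<open>a\<close> in the nonempty carrier, one of
    \<open>a\<close> and \<open>g_neg A a\<close> lies outside \<open>B\<close>.\<close>
  moreover have "prime_set A B"
    using * by (auto simp: prime_set_def proper_def two_valued_def is_sci_algebra_def)
  ultimately show "bloom_suszko_model A B"
    using * admissible_if_two_valued by (auto simp: bloom_suszko_model_def sci_filter_def)
qed

section \<open>Ultrafilters of a Boolean algebra on a carrier set\<close>

locale boolean_algebra_set =
  fixes S :: "('a, 'm) bool_struct_scheme"
  assumes boolean_algebra: "boolean_algebra_on S"
begin

lemma closed [simp]:
  "x \<in> carr S \<Longrightarrow> y \<in> carr S \<Longrightarrow> f_and S x y \<in> carr S"
  "x \<in> carr S \<Longrightarrow> y \<in> carr S \<Longrightarrow> f_or S x y \<in> carr S"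
  "x \<in> carr S \<Longrightarrow> f_neg S x \<in> carr S"
  "f_bot S \<in> carr S"
  "f_top S \<in> carr S"
  using boolean_algebra unfolding boolean_algebra_on_def closed_ops_def by blast+

lemma
  assumes "x \<in> carr S" "y \<in> carr S"
  shows or_commute: "f_or S x y = f_or S y x"
    and and_commute: "f_and S x y = f_and S y x"
    and or_absorb: "f_or S x (f_and S x y) = x"
    and and_absorb: "f_and S x (f_or S x y) = x"
    and imp_eq: "f_imp S x y = f_or S (f_neg S x) y"
  using boolean_algebra assms unfolding boolean_algebra_on_def by blast+

lemma
  assumes "x \<in> carr S" "y \<in> carr S" "z \<in> carr S"
  shows and_assoc: "f_and S (f_and S x y) z = f_and S x (f_and S y z)"
    and and_distrib: "f_and S x (f_or S y z) = f_or S (f_and S x y) (f_and S x z)"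
  using boolean_algebra assms unfolding boolean_algebra_on_def by blast+

lemma
  assumes "x \<in> carr S"
  shows or_bot: "f_or S x (f_bot S) = x"
    and and_top: "f_and S x (f_top S) = x"
    and or_neg: "f_or S x (f_neg S x) = f_top S"
    and and_neg: "f_and S x (f_neg S x) = f_bot S"
  using boolean_algebra assms unfolding boolean_algebra_on_def by blast+

lemma and_idem:
  assumes "x \<in> carr S"
  shows "f_and S x x = x"
  using assms by (metis and_absorb or_absorb closed(1))

lemma bot_or:
  assumes "x \<in> carr S"
  shows "f_or S (f_bot S) x = x"
  using assms by (metis or_bot or_commute closed(4))

lemma bot_and:
  assumes "x \<in> carr S"
  shows "f_and S (f_bot S) x = f_bot S"
  using assms by (metis and_absorb bot_or closed(4))

lemma and_left_commute:
  assumes "x \<in> carr S" "y \<in> carr S" "z \<in> carr S"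
  shows "f_and S x (f_and S y z) = f_and S y (f_and S x z)"
  using assms by (metis and_assoc and_commute)

lemma and_left_idem:
  assumes "x \<in> carr S" "y \<in> carr S"
  shows "f_and S x (f_and S x y) = f_and S x y"
  using assms by (metis and_assoc and_idem)

text \<open>Rewriting with these rules orders the factors of a meet and drops repetitions, so meets
  with the same factors become equal.\<close>

lemmas and_ac = and_assoc and_commute and_left_commute and_left_idem and_idem

text \<open>Split \<open>x\<close>, as its meet with top, along \<open>y\<close> and its complement;
  the part inside \<open>y\<close> is bottom.\<close>

lemma and_neg_eq_if_disjoint:
  assumes "x \<in> carr S" "y \<in> carr S" "f_and S x y = f_bot S"
  shows "f_and S x (f_neg S y) = x"
  using and_distrib[of x y "f_neg S y"] assms by (simp add: or_neg and_top bot_or)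

text \<open>The filter generated by \<open>F\<close> and \<open>a\<close>: all elements above the
  meet of \<open>a\<close> with some \<open>f\<close> in \<open>F\<close>, where \<open>u\<close>
  below \<open>v\<close> is written as \<open>f_and S u v = u\<close>. If \<open>x\<close> lies
  above the meet of \<open>f\<close> and \<open>a\<close>, and \<open>y\<close> above that of
  \<open>g\<close> and \<open>a\<close>, then \<open>f_and S f g\<close> is a witness for their
  meet.\<close>

lemma filter_generated:
  assumes F: "ba_filter S F" and a: "a \<in> carr S"
  shows "ba_filter S {x \<in> carr S. \<exists>f\<in>F. f_and S (f_and S f a) x = f_and S f a}"
    (is "ba_filter S ?G")
proof -
  have FS: "f \<in> carr S" if "f \<in> F" for f
    using F that by (auto simp: ba_filter_def)
  obtain f where "f \<in> F"
    using F by (auto simp: ba_filter_def)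
  then have "a \<in> ?G"
    using FS a by (auto simp: and_ac intro!: bexI[of _ f])
  moreover have "f_and S x y \<in> ?G" if "x \<in> ?G" "y \<in> ?G" for x y
  proof -
    obtain f g where fg: "f \<in> F" "g \<in> F" "x \<in> carr S" "y \<in> carr S"
      and f: "f_and S (f_and S f a) x = f_and S f a"
      and g: "f_and S (f_and S g a) y = f_and S g a"
      using \<open>x \<in> ?G\<close> \<open>y \<in> ?G\<close> by blast
    have "f_and S (f_and S (f_and S f g) a) (f_and S x y) =
        f_and S (f_and S (f_and S f a) x) (f_and S (f_and S g a) y)"
      using fg FS a by (simp add: and_ac)
    also have "\<dots> = f_and S (f_and S f g) a"
      unfolding f g using fg FS a by (simp add: and_ac)
    finally show ?thesis
      using fg F by (auto simp: ba_filter_def)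
  qed
  moreover have "y \<in> ?G" if "x \<in> ?G" "y \<in> carr S" "f_and S x y = x" for x y
  proof -
    obtain f where f: "f \<in> F" "x \<in> carr S" "f_and S (f_and S f a) x = f_and S f a"
      using \<open>x \<in> ?G\<close> by blast
    then have "f_and S (f_and S f a) y = f_and S (f_and S f a) (f_and S x y)"
      using FS a that(2) by (metis and_assoc closed(1))
    then show ?thesis
      using f that by auto
  qed
  ultimately show ?thesis
    unfolding ba_filter_def by blast
qed

text \<open>An element and its complement together would put bottom, hence everything, into
  \<open>F\<close>. If \<open>a\<close> is missing, the filter generated by \<open>F\<close> and
  \<open>a\<close> is strictly larger, so by maximality it contains bottom; some \<open>f\<close> in
  \<open>F\<close> is then disjoint from \<open>a\<close> and so lies below
  \<open>f_neg S a\<close>.\<close>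

lemma ultrafilter_neg:
  assumes U: "ba_ultrafilter S F" and a: "a \<in> carr S"
  shows "f_neg S a \<in> F \<longleftrightarrow> a \<notin> F"
proof
  have F: "ba_filter S F" and proper: "F \<noteq> carr S"
    using U by (auto simp: ba_ultrafilter_def)
  have up: "y \<in> F" if "x \<in> F" "y \<in> carr S" "f_and S x y = x" for x y
    using F that by (auto simp: ba_filter_def)
  have FS: "f \<in> carr S" if "f \<in> F" for f
    using F that by (auto simp: ba_filter_def)
  {
    assume "f_neg S a \<in> F"
    show "a \<notin> F"
    proof
      assume "a \<in> F"
      then have "f_bot S \<in> F"
        using F \<open>f_neg S a \<in> F\<close> by (simp add: ba_filter_def flip: and_neg[OF a])
      then have "carr S \<subseteq> F"
        using up bot_and by blast
      then show False
        using proper FS by blast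
    qed
  next
    assume "a \<notin> F"
    let ?G = "{x \<in> carr S. \<exists>f\<in>F. f_and S (f_and S f a) x = f_and S f a}"
    have "g \<in> ?G" if "g \<in> F" for g
      using FS[OF that] that a by (auto simp: and_ac intro!: bexI[of _ g])
    moreover obtain f where "f \<in> F"
      using F by (auto simp: ba_filter_def)
    then have "a \<in> ?G"
      using FS[OF \<open>f \<in> F\<close>] a by (auto simp: and_ac intro!: bexI[of _ f])
    ultimately have "?G = carr S"
      using U filter_generated[OF F a] \<open>a \<notin> F\<close> unfolding ba_ultrafilter_def by blast
    then have "f_bot S \<in> ?G"
      by simp
    then obtain f where f: "f \<in> F" "f_and S (f_and S f a) (f_bot S) = f_and S f a"
      by blast
    then have "f_and S f a = f_bot S"
      using FS a by (metis bot_and and_commute closed(1,4))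
    then have "f_and S f (f_neg S a) = f"
      using and_neg_eq_if_disjoint FS f(1) a by blast
    then show "f_neg S a \<in> F"
      using up f(1) a by simp
  }
qed

text \<open>If \<open>a\<close> is missing, its complement is in \<open>F\<close>, and the meet of
  that complement with the join lies below \<open>b\<close>. The converse is upward closure, by
  absorption.\<close>

lemma ultrafilter_or:
  assumes U: "ba_ultrafilter S F" and ab: "a \<in> carr S" "b \<in> carr S"
  shows "f_or S a b \<in> F \<longleftrightarrow> a \<in> F \<or> b \<in> F"
proof
  have F: "ba_filter S F"
    using U by (auto simp: ba_ultrafilter_def)
  have up: "y \<in> F" if "x \<in> F" "y \<in> carr S" "f_and S x y = x" for x y
    using F that by (auto simp: ba_filter_def)
  {
    assume or: "f_or S a b \<in> F"
    show "a \<in> F \<or> b \<in> F"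
    proof (cases "a \<in> F")
      case False
      then have neg: "f_neg S a \<in> F"
        using ultrafilter_neg[OF U ab(1)] by simp
      have "f_and S (f_neg S a) (f_or S a b) = f_and S (f_neg S a) b"
        using ab and_distrib[of "f_neg S a" a b] and_commute[of "f_neg S a" a]
        by (simp add: and_neg bot_or)
      then have "f_and S (f_neg S a) b \<in> F"
        using F neg or by (simp add: ba_filter_def flip: \<open>_ = f_and S (f_neg S a) b\<close>)
      then show ?thesis
        using up[of "f_and S (f_neg S a) b" b] ab by (simp add: and_ac)
    qed simp
  next
    assume "a \<in> F \<or> b \<in> F"
    then show "f_or S a b \<in> F"
      using up[of a "f_or S a b"] up[of b "f_or S a b"] ab and_absorb[of a b] and_absorb[of b a]
        or_commute[of a b] by auto
  }
qed

end

section \<open>Quotients, and from SCI-models to Bloom-Suszko models\<close>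

lemma quotient_struct_simps:
  assumes "is_congruence S r" "a \<in> carr S" "b \<in> carr S"
  shows "f_or (quotient_struct S r) (r `` {a}) (r `` {b}) = r `` {f_or S a b}"
    and "f_and (quotient_struct S r) (r `` {a}) (r `` {b}) = r `` {f_and S a b}"
    and "f_imp (quotient_struct S r) (r `` {a}) (r `` {b}) = r `` {f_imp S a b}"
    and "f_neg (quotient_struct S r) (r `` {a}) = r `` {f_neg S a}"
proof -
  have r: "equiv (carr S) r"
    using assms by (simp add: is_congruence_def)
  have "congruent2 r r (\<lambda>x y. r `` {f_or S x y})"
    "congruent2 r r (\<lambda>x y. r `` {f_and S x y})"
    "congruent2 r r (\<lambda>x y. r `` {f_imp S x y})"
    using assms(1) equiv_class_eq[OF r]
    by (auto simp: is_congruence_def congruent2_def, blast+)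
  moreover have "congruent r (\<lambda>x. r `` {f_neg S x})"
    using assms(1) equiv_class_eq[OF r] by (auto simp: is_congruence_def congruent_def, blast+)
  ultimately show "f_or (quotient_struct S r) (r `` {a}) (r `` {b}) = r `` {f_or S a b}"
    "f_and (quotient_struct S r) (r `` {a}) (r `` {b}) = r `` {f_and S a b}"
    "f_imp (quotient_struct S r) (r `` {a}) (r `` {b}) = r `` {f_imp S a b}"
    "f_neg (quotient_struct S r) (r `` {a}) = r `` {f_neg S a}"
    using assms r
    by (simp_all add: quotient_struct_def UN_equiv_class2[OF r r] UN_equiv_class[OF r])
qed

lemma quotient_struct_carr: "carr (quotient_struct S r) = (\<lambda>a. r `` {a}) ` carr S"
  by (auto simp: quotient_struct_def quotient_def)

text \<open>Negation and implication are computed in the quotient, where the ultrafilter is prime,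
  and pulled back to \<open>M\<close>. The identity condition is already one on elements of
  \<open>M\<close>.\<close>

lemma two_valued_if_sci_model:
  assumes "sci_model M"
  shows "two_valued \<lparr>base = carr M, g_neg = f_neg M, g_imp = f_imp M, g_id = f_id M\<rparr> (TRUE M)"
proof -
  let ?r = "approx M"
  let ?Q = "quotient_struct M ?r"
  let ?F = "{?r `` {a} | a. a \<in> TRUE M}"
  have pre: "boolean_prealgebra M" and U: "ba_ultrafilter ?Q ?F"
    and sub: "TRUE M \<subseteq> carr M" and sat: "\<forall>(a, b)\<in>?r. a \<in> TRUE M \<longleftrightarrow> b \<in> TRUE M"
    and idn: "\<forall>m\<in>carr M. \<forall>m'\<in>carr M. f_id M m m' \<in> TRUE M \<longleftrightarrow> m = m'"
    using assms by (auto simp: sci_model_def prealgebra_ultrafilter_def)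
  have cong: "is_congruence M ?r" and "boolean_algebra_on ?Q" and "closed_ops M"
    using pre by (auto simp: boolean_prealgebra_def)
  then interpret Q: boolean_algebra_set ?Q
    by unfold_locales
  have closed: "f_neg M a \<in> carr M" "f_imp M a b \<in> carr M" if "a \<in> carr M" "b \<in> carr M" for a b
    using \<open>closed_ops M\<close> that by (auto simp: closed_ops_def)
  have r: "equiv (carr M) ?r"
    using cong by (simp add: is_congruence_def)
  \<comment> \<open>A class in \<open>?F\<close> may be given by another representative; closure of
    \<open>TRUE M\<close> under \<open>approx M\<close> allows the change.\<close>
  have mem: "?r `` {a} \<in> ?F \<longleftrightarrow> a \<in> TRUE M" if "a \<in> carr M" for a
    using eq_equiv_class_iff[OF r that] sub sat by blast
  have Q: "?r `` {a} \<in> carr ?Q" if "a \<in> carr M" for a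
    using that by (simp add: quotient_struct_carr)
  have neg: "f_neg M a \<in> TRUE M \<longleftrightarrow> a \<notin> TRUE M" if "a \<in> carr M" for a
    using Q.ultrafilter_neg[OF U Q[OF that]] that closed
    by (simp only: quotient_struct_simps[OF cong] mem)
  have imp: "f_imp M a b \<in> TRUE M \<longleftrightarrow> (a \<in> TRUE M \<longrightarrow> b \<in> TRUE M)"
    if "a \<in> carr M" "b \<in> carr M" for a b
  proof -
    note ab = Q[OF that(1)] Q[OF that(2)]
    \<comment> \<open>In \<open>M\<close> itself, implication need not be the join with a negation;
      the equation holds between classes.\<close>
    have "?r `` {f_imp M a b} = f_or ?Q (f_neg ?Q (?r `` {a})) (?r `` {b})"
      using Q.imp_eq[OF ab] quotient_struct_simps(3)[OF cong that] by simp
    then have "?r `` {f_imp M a b} \<in> ?F \<longleftrightarrow> (?r `` {a} \<in> ?F \<longrightarrow> ?r `` {b} \<in> ?F)"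
      using Q.ultrafilter_or[OF U Q.closed(3)[OF ab(1)] ab(2)] Q.ultrafilter_neg[OF U ab(1)]
      by (simp only: imp_conv_disj)
    then show ?thesis
      unfolding mem[OF that(1)] mem[OF that(2)] mem[OF closed(2)[OF that]] .
  qed
  show ?thesis
    using neg imp idn by (simp add: two_valued_def)
qed

text \<open>By \<open>bloom_suszko_model_iff\<close>, what remains besides two-valuedness is closure
  under the operations and a nonempty carrier, which the constants provide.\<close>

lemma bloom_suszko_model_if_sci_model:
  assumes "sci_model M"
  shows "bloom_suszko_model
    \<lparr>base = carr M, g_neg = f_neg M, g_imp = f_imp M, g_id = f_id M\<rparr> (TRUE M)"
proof -
  have "closed_ops M"
    using assms by (simp add: sci_model_def boolean_prealgebra_def)
  then show ?thesis
    using assms two_valued_if_sci_model[OF assms]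
    by (auto simp: bloom_suszko_model_iff is_sci_algebra_def sci_model_def closed_ops_def
        prealgebra_ultrafilter_def)
qed

section \<open>From Bloom-Suszko models to SCI-models\<close>

text \<open>Equivalent elements are those that agree on membership in \<open>B\<close>, so there are
  exactly two classes, of true and of false elements, inhabited by top and bottom. The quotient is
  the two-element Boolean algebra, and \<open>B\<close> corresponds to its only ultrafilter.\<close>

lemma prealgebra_if_truth_functional:
  fixes S :: "('a, 'm) bool_prestruct_scheme"
  assumes closed: "closed_ops S" and sub: "B \<subseteq> carr S"
    and le: "le S = {(a, b). a \<in> carr S \<and> b \<in> carr S \<and> (a \<in> B \<longrightarrow> b \<in> B)}"
    and or: "\<And>a b. a \<in> carr S \<Longrightarrow> b \<in> carr S \<Longrightarrow> f_or S a b \<in> B \<longleftrightarrow> a \<in> B \<or> b \<in> B"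
    and "and": "\<And>a b. a \<in> carr S \<Longrightarrow> b \<in> carr S \<Longrightarrow> f_and S a b \<in> B \<longleftrightarrow> a \<in> B \<and> b \<in> B"
    and imp: "\<And>a b. a \<in> carr S \<Longrightarrow> b \<in> carr S \<Longrightarrow> f_imp S a b \<in> B \<longleftrightarrow> (a \<in> B \<longrightarrow> b \<in> B)"
    and neg: "\<And>a. a \<in> carr S \<Longrightarrow> f_neg S a \<in> B \<longleftrightarrow> a \<notin> B"
    and bot: "f_bot S \<notin> B" and top: "f_top S \<in> B"
  shows "boolean_prealgebra S" and "prealgebra_ultrafilter S B"
proof -
  let ?r = "approx S"
  let ?Q = "quotient_struct S ?r"
  let ?F = "{?r `` {a} | a. a \<in> B}"
  note truth = or "and" imp neg bot top
  have carr: "f_or S a b \<in> carr S" "f_and S a b \<in> carr S" "f_imp S a b \<in> carr S"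
    "f_neg S a \<in> carr S" "f_bot S \<in> carr S" "f_top S \<in> carr S"
    if "a \<in> carr S" "b \<in> carr S" for a b
    using closed that by (auto simp: closed_ops_def)
  have bt: "f_bot S \<in> carr S" "f_top S \<in> carr S"
    using closed by (auto simp: closed_ops_def)
  have approx: "?r = {(a, b). a \<in> carr S \<and> b \<in> carr S \<and> (a \<in> B \<longleftrightarrow> b \<in> B)}"
    by (auto simp: approx_def le)
  have r: "equiv (carr S) ?r"
    by (auto simp: approx equiv_def refl_on_def sym_def trans_def)
  have cong: "is_congruence S ?r"
    unfolding is_congruence_def using r by (auto simp: approx truth carr)
  have eq: "?r `` {a} = ?r `` {b} \<longleftrightarrow> (a \<in> B \<longleftrightarrow> b \<in> B)" if "a \<in> carr S" "b \<in> carr S" for a b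
    using eq_equiv_class_iff[OF r that] that by (simp add: approx)
  note quotient = quotient_struct_simps[OF cong]
  have units: "f_bot ?Q = ?r `` {f_bot S}" "f_top ?Q = ?r `` {f_top S}"
    by (simp_all add: quotient_struct_def)
  \<comment> \<open>Each law equates two classes; \<open>eq\<close> turns it into a propositional
    equivalence about membership in \<open>B\<close>, which \<open>truth\<close> settles.\<close>
  have "boolean_algebra_on ?Q"
    unfolding boolean_algebra_on_def closed_ops_def quotient_struct_carr units
    by (auto simp: quotient eq carr bt truth)
  moreover have "preorder_on (carr S) (le S)"
    by (auto simp: preorder_on_def refl_on_def trans_def le)
  moreover have "(a, b) \<in> le S \<longleftrightarrow> (f_and S a b, a) \<in> ?r" if "a \<in> carr S" "b \<in> carr S" for a b
    using that by (auto simp: le approx carr truth)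
  ultimately show "boolean_prealgebra S"
    using closed cong by (simp add: boolean_prealgebra_def)
  have mem: "?r `` {a} \<in> ?F \<longleftrightarrow> a \<in> B" if "a \<in> carr S" for a
    using eq[OF that] sub by blast
  have FQ: "?F \<subseteq> carr ?Q"
    using sub by (auto simp: quotient_struct_carr)
  have "ba_filter ?Q ?F"
    unfolding ba_filter_def
  proof (intro conjI ballI impI)
    show "?F \<noteq> {}"
      using top by blast
  next
    fix X Y assume "X \<in> ?F" "Y \<in> ?F"
    then obtain a b where "X = ?r `` {a}" "Y = ?r `` {b}" "a \<in> B" "b \<in> B"
      by blast
    then have ab: "a \<in> carr S" "b \<in> carr S"
      using sub by auto
    have "f_and S a b \<in> B"
      using "and"[OF ab] \<open>a \<in> B\<close> \<open>b \<in> B\<close> by simp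
    then have "?r `` {f_and S a b} \<in> ?F"
      by blast
    then show "f_and ?Q X Y \<in> ?F"
      unfolding \<open>X = _\<close> \<open>Y = _\<close> quotient(2)[OF ab] .
  next
    fix X Y assume "X \<in> ?F" "Y \<in> carr ?Q" "f_and ?Q X Y = X"
    then obtain a b where "X = ?r `` {a}" "Y = ?r `` {b}" "a \<in> B" "b \<in> carr S"
      by (auto simp: quotient_struct_carr)
    then have ab: "a \<in> carr S" "b \<in> carr S"
      using sub by auto
    have "?r `` {f_and S a b} = ?r `` {a}"
      using \<open>f_and ?Q X Y = X\<close> unfolding \<open>X = _\<close> \<open>Y = _\<close> quotient(2)[OF ab] .
    then have "b \<in> B"
      using eq[OF carr(2)[OF ab] ab(1)] "and"[OF ab] \<open>a \<in> B\<close> by simp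
    then show "Y \<in> ?F"
      unfolding \<open>Y = _\<close> by blast
  qed (rule FQ)
  moreover have "?F \<noteq> carr ?Q"
    using mem[OF bt(1)] bot bt(1) unfolding quotient_struct_carr by blast
  \<comment> \<open>A strictly larger filter contains the class of some false element. All false
    elements share that class, so the filter contains every class and is improper.\<close>
  moreover have "G = ?F" if G: "ba_filter ?Q G" "G \<noteq> carr ?Q" "?F \<subseteq> G" for G
  proof (rule ccontr)
    assume "G \<noteq> ?F"
    have GQ: "G \<subseteq> carr ?Q"
      using G by (simp add: ba_filter_def)
    obtain X where "X \<in> G" "X \<notin> ?F"
      using G(3) \<open>G \<noteq> ?F\<close> by blast
    moreover from this obtain a where "X = ?r `` {a}" "a \<in> carr S"
      using GQ unfolding quotient_struct_carr by blast
    ultimately have a: "?r `` {a} \<in> G" "a \<in> carr S" "a \<notin> B"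
      using mem by auto
    have "?r `` {b} \<in> G" if "b \<in> carr S" for b
    proof (cases "b \<in> B")
      case False
      then have "?r `` {b} = ?r `` {a}"
        using eq a that by simp
      then show ?thesis
        using a by simp
    qed (use G(3) in blast)
    then show False
      using G(2) GQ unfolding quotient_struct_carr by blast
  qed
  ultimately have "ba_ultrafilter ?Q ?F"
    unfolding ba_ultrafilter_def by blast
  then show "prealgebra_ultrafilter S B"
    using sub by (auto simp: prealgebra_ultrafilter_def approx)
qed

lemma sci_model_if_bloom_suszko_model:
  assumes "bloom_suszko_model A B" "a0 \<in> base A"
  shows "sci_model
    \<lparr>carr = base A,
     f_or = (\<lambda>a b. g_imp A (g_neg A a) b),
     f_and = (\<lambda>a b. g_neg A (g_imp A a (g_neg A b))),
     f_neg = g_neg A,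
     f_bot = g_neg A (g_imp A a0 a0),
     f_top = g_imp A a0 a0,
     f_imp = g_imp A,
     le = {(a, b). a \<in> base A \<and> b \<in> base A \<and> g_imp A a b \<in> B},
     TRUE = B,
     f_id = g_id A\<rparr>" (is "sci_model ?M")
proof -
  have alg: "is_sci_algebra A" and sub: "B \<subseteq> base A" and tv: "two_valued A B"
    using assms by (auto simp: bloom_suszko_model_iff)
  have closed: "closed_ops ?M"
    using alg assms(2) by (simp add: is_sci_algebra_def closed_ops_def)
  have carr: "g_neg A a \<in> base A" "g_imp A a b \<in> base A" "g_id A a b \<in> base A"
    if "a \<in> base A" "b \<in> base A" for a b
    using alg that by (auto simp: is_sci_algebra_def)
  have truth: "g_neg A a \<in> B \<longleftrightarrow> a \<notin> B" "g_imp A a b \<in> B \<longleftrightarrow> (a \<in> B \<longrightarrow> b \<in> B)"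
    "g_id A a b \<in> B \<longleftrightarrow> a = b"
    if "a \<in> base A" "b \<in> base A" for a b
    using tv that by (auto simp: two_valued_def)
  \<comment> \<open>The premises are the truth tables of the defined operations.
    \<open>g_imp A a0 a0\<close> is in \<open>B\<close> whether or not \<open>a0\<close> is, so top
    is true and bottom false.\<close>
  have "boolean_prealgebra ?M" "prealgebra_ultrafilter ?M B"
    using assms(2) sub
    by (intro prealgebra_if_truth_functional[where B = B] closed; auto simp: carr truth)+
  then show ?thesis
    by (simp add: sci_model_def carr truth)
qed

theorem theorem3p9:
  fixes M :: "'a sci_struct"
    and A :: "'b sci_algebra" and B :: "'b set" and a0 :: 'b
  shows
    "(sci_model M \<longrightarrow>
        bloom_suszko_model
          \<lparr>base = carr M, g_neg = f_neg M, g_imp = f_imp M, g_id = f_id M\<rparr>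
          (TRUE M)) \<and>
     (bloom_suszko_model A B \<and> a0 \<in> base A \<longrightarrow>
        sci_model
          \<lparr>carr = base A,
           f_or = (\<lambda>a b. g_imp A (g_neg A a) b),
           f_and = (\<lambda>a b. g_neg A (g_imp A a (g_neg A b))),
           f_neg = g_neg A,
           f_bot = g_neg A (g_imp A a0 a0),
           f_top = g_imp A a0 a0,
           f_imp = g_imp A,
           le = {(a, b). a \<in> base A \<and> b \<in> base A \<and> g_imp A a b \<in> B},
           TRUE = B,
           f_id = g_id A\<rparr>)"
  by (intro conjI impI bloom_suszko_model_if_sci_model sci_model_if_bloom_suszko_model; simp)

end
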